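(* $\operatorname{BSR}(5,4)\ge 12$.
   Context: An $m\times n$ biquadratic form is a polynomial $P(\mathbf{x},\mathbf{y})=\sum_{i=1}^m\sum_{j=1}^n\sum_{k=1}^m\sum_{l=1}^n a_{ijkl}\,x_i x_k y_j y_l$ with real coefficients, where $\mathbf{x}=(x_1,\dots,x_m)$ and $\mathbf{y}=(y_1,\dots,y_n)$. A bilinear form is a polynomial $\ell(\mathbf{x},\mathbf{y})=\sum_{i=1}^m\sum_{j=1}^n a_{ij}x_i y_j$ with real coefficients. For a biquadratic form $P$ that is a sum of squares of bilinear forms, the SOS rank $\operatorname{sos}(P)$ is the minimal number $r$ such that $P=\sum_{k=1}^r \ell_k(\mathbf{x},\mathbf{y})^2$ for some bilinear forms $\ell_1,\dots,\ell_r$. For positive integers $m,n$, $\operatorname{BSR}(m,n)$ denotes the maximum of $\operatorname{sos}(P)$ over all $m\times n$ biquadratic forms $P$ that are sums of squares of bilinear forms. *)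

theory Defs
  imports Complex_Main
begin

text \<open>
  Forms are represented by the real polynomial functions they induce; over the (infinite) field
  of reals, a polynomial and its polynomial function determine each other. The variables
  \<open>x\<^sub>1, \<dots>, x\<^sub>m\<close> and \<open>y\<^sub>1, \<dots>, y\<^sub>n\<close> are indexed from 0: they are \<open>x i\<close> with \<open>i < m\<close> and
  \<open>y j\<close> with \<open>j < n\<close>.
\<close>

type_synonym form = "(nat \<Rightarrow> real) \<Rightarrow> (nat \<Rightarrow> real) \<Rightarrow> real"

definition biquadratic_form :: "nat \<Rightarrow> nat \<Rightarrow> form \<Rightarrow> bool" where
  "biquadratic_form m n P \<longleftrightarrow>
    (\<exists>a :: nat \<Rightarrow> nat \<Rightarrow> nat \<Rightarrow> nat \<Rightarrow> real.
       P = (\<lambda>x y. \<Sum>i<m. \<Sum>j<n. \<Sum>k<m. \<Sum>l<n. a i j k l * x i * x k * y j * y l))"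

definition bilinear_form :: "nat \<Rightarrow> nat \<Rightarrow> form \<Rightarrow> bool" where
  "bilinear_form m n f \<longleftrightarrow>
    (\<exists>a :: nat \<Rightarrow> nat \<Rightarrow> real. f = (\<lambda>x y. \<Sum>i<m. \<Sum>j<n. a i j * x i * y j))"

definition sum_of_squares :: "nat \<Rightarrow> nat \<Rightarrow> nat \<Rightarrow> form \<Rightarrow> bool" where
  "sum_of_squares m n r P \<longleftrightarrow>
    (\<exists>f :: nat \<Rightarrow> form. (\<forall>k<r. bilinear_form m n (f k)) \<and> P = (\<lambda>x y. \<Sum>k<r. (f k x y)\<^sup>2))"

text \<open>Meaningful only if \<open>sum_of_squares m n r P\<close> holds for some \<open>r\<close>.\<close>

definition sos_rank :: "nat \<Rightarrow> nat \<Rightarrow> form \<Rightarrow> nat" where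
  "sos_rank m n P = (LEAST r. sum_of_squares m n r P)"

text \<open>
  The maximum exists: a sum of squares of linear forms in the \<open>m * n\<close> products \<open>x i * y j\<close>
  can always be rewritten with at most \<open>m * n\<close> squares, so the set of ranks is finite, and
  it contains the rank 0 of the zero form.
\<close>

definition BSR :: "nat \<Rightarrow> nat \<Rightarrow> nat" where
  "BSR m n =
    Max {sos_rank m n P | P. biquadratic_form m n P \<and> (\<exists>r. sum_of_squares m n r P)}"

end

theory Submission
  imports Defs
begin

text \<open>
  The form with rank at least 12 is a sum of ten squares \<open>(x i * y j)\<^sup>2\<close>, over the edges of a
  bipartite graph without 4-cycles, and of two squares \<open>(x i * y j + x k * y l)\<^sup>2\<close> supported on
  four of the ten non-edges. Two Gram matrices of the same form differ by a matrix \<open>D\<close> with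
  \<open>D ij kl + D il kj = 0\<close>. The form vanishes at the six remaining products of unit vectors,
  so those columns of any sum-of-squares representation vanish, and the two columns belonging to
  a common square coincide. Under these constraints the Gram matrix of the form is unique.
  Hence the coefficients of any representation with \<open>r\<close> squares give 12 orthonormal vectors
  in an \<open>r\<close>-dimensional space.
\<close>

section \<open>Sums of squares and their Gram matrices\<close>

definition bilin :: "nat \<Rightarrow> nat \<Rightarrow> (nat \<Rightarrow> nat \<Rightarrow> real) \<Rightarrow> form" where
  "bilin m n a = (\<lambda>x y. \<Sum>i<m. \<Sum>j<n. a i j * x i * y j)"

definition gram :: "nat \<Rightarrow> (nat \<Rightarrow> nat \<Rightarrow> nat \<Rightarrow> real) \<Rightarrow> nat \<Rightarrow> nat \<Rightarrow> nat \<Rightarrow> nat \<Rightarrow> real" where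
  "gram r c i j k l = (\<Sum>t<r. c t i j * c t k l)"

lemma sum_of_squares_iff:
  "sum_of_squares m n r P \<longleftrightarrow> (\<exists>c. P = (\<lambda>x y. \<Sum>t<r. (bilin m n (c t) x y)\<^sup>2))"
proof
  assume "sum_of_squares m n r P"
  then obtain f where "(\<forall>t<r. bilinear_form m n (f t)) \<and> P = (\<lambda>x y. \<Sum>t<r. (f t x y)\<^sup>2)"
    unfolding sum_of_squares_def ..
  then have f: "\<forall>t<r. bilinear_form m n (f t)" and P: "P = (\<lambda>x y. \<Sum>t<r. (f t x y)\<^sup>2)"
    by blast+
  from f have "\<forall>t. t < r \<longrightarrow> (\<exists>a. f t = bilin m n a)"
    unfolding bilinear_form_def bilin_def .
  then obtain c where "\<And>t. t < r \<Longrightarrow> f t = bilin m n (c t)"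
    by metis
  then have "P = (\<lambda>x y. \<Sum>t<r. (bilin m n (c t) x y)\<^sup>2)"
    unfolding P by (intro ext sum.cong) simp_all
  then show "\<exists>c. P = (\<lambda>x y. \<Sum>t<r. (bilin m n (c t) x y)\<^sup>2)" by blast
next
  assume "\<exists>c. P = (\<lambda>x y. \<Sum>t<r. (bilin m n (c t) x y)\<^sup>2)"
  then obtain c where c: "P = (\<lambda>x y. \<Sum>t<r. (bilin m n (c t) x y)\<^sup>2)" ..
  have "bilinear_form m n (bilin m n (c t))" for t
    unfolding bilinear_form_def bilin_def by (rule exI) (rule refl)
  with c show "sum_of_squares m n r P"
    unfolding sum_of_squares_def by (intro exI[of _ "\<lambda>t. bilin m n (c t)"]) simp
qed

lemma sum_bilin_squared:
  "(\<Sum>t<r. (bilin m n (c t) x y)\<^sup>2)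
    = (\<Sum>i<m. \<Sum>j<n. \<Sum>k<m. \<Sum>l<n. gram r c i j k l * x i * x k * y j * y l)"
proof -
  have "(\<Sum>t<r. (bilin m n (c t) x y)\<^sup>2)
      = (\<Sum>t<r. \<Sum>i<m. \<Sum>j<n. \<Sum>k<m. \<Sum>l<n. (c t i j * x i * y j) * (c t k l * x k * y l))"
    by (simp add: bilin_def power2_eq_square sum_distrib_right) (simp add: sum_distrib_left)
  also have "\<dots> = (\<Sum>i<m. \<Sum>j<n. \<Sum>k<m. \<Sum>l<n. \<Sum>t<r. (c t i j * x i * y j) * (c t k l * x k * y l))"
    by (simp add: sum.swap[of _ _ "{..<r}"])
  also have "\<dots> = (\<Sum>i<m. \<Sum>j<n. \<Sum>k<m. \<Sum>l<n. gram r c i j k l * x i * x k * y j * y l)"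
    by (simp add: gram_def sum_distrib_left sum_distrib_right mult_ac)
  finally show ?thesis .
qed

lemma biquadratic_form_if_sum_of_squares:
  assumes "sum_of_squares m n r P"
  shows "biquadratic_form m n P"
  using assms unfolding sum_of_squares_iff biquadratic_form_def sum_bilin_squared by blast

section \<open>Bounding the number of squares\<close>

text \<open>
  Gram--Schmidt on the columns of \<open>c\<close>. If column \<open>a\<close> vanishes, then so do \<open>g a\<close> and, as
  division by 0 gives 0, the projection.
\<close>

lemma gram_square_factor:
  fixes c :: "'k \<Rightarrow> 'z \<Rightarrow> real"
  assumes "finite Z" "finite K"
  shows "\<exists>d :: 'z \<Rightarrow> 'z \<Rightarrow> real. \<forall>z\<in>Z. \<forall>w\<in>Z.
           (\<Sum>k\<in>K. c k z * c k w) = (\<Sum>k\<in>Z. d k z * d k w)"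
  using assms(1)
proof (induction Z arbitrary: c rule: finite_induct)
  case empty
  then show ?case by simp
next
  case (insert a Z)
  define g where "g z = (\<Sum>k\<in>K. c k a * c k z)" for z
  have g_sym: "(\<Sum>k\<in>K. c k z * c k a) = g z" for z
    by (simp add: g_def mult.commute)
  define c' where "c' k z = c k z - c k a * g z / g a" for k z
  obtain d where d: "\<And>z w. z \<in> Z \<Longrightarrow> w \<in> Z \<Longrightarrow>
      (\<Sum>k\<in>K. c' k z * c' k w) = (\<Sum>k\<in>Z. d k z * d k w)"
    using insert.IH[of c'] by blast
  have ga: "g a \<ge> 0" by (simp add: g_def sum_nonneg)
  have g0: "g z = 0" if "g a = 0" for z
  proof -
    have "\<forall>k\<in>K. c k a = 0"
      using that assms(2) by (simp add: g_def sum_nonneg_eq_0_iff)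
    then show ?thesis by (simp add: g_def)
  qed
  have proj: "(\<Sum>k\<in>K. c' k z * c' k w) = (\<Sum>k\<in>K. c k z * c k w) - g z * g w / g a" for z w
  proof -
    have "(\<Sum>k\<in>K. c' k z * c' k w) =
        (\<Sum>k\<in>K. c k z * c k w) - (\<Sum>k\<in>K. c k a * c k w) * (g z / g a)
          - (\<Sum>k\<in>K. c k a * c k z) * (g w / g a) + (\<Sum>k\<in>K. c k a * c k a) * (g z * g w / (g a * g a))"
      unfolding sum_distrib_right sum_subtractf[symmetric] sum.distrib[symmetric]
      by (rule sum.cong) (simp_all add: c'_def algebra_simps)
    also have "\<dots> = (\<Sum>k\<in>K. c k z * c k w) - g w * (g z / g a)
        - g z * (g w / g a) + g a * (g z * g w / (g a * g a))"
      by (simp add: g_def)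
    also have "\<dots> = (\<Sum>k\<in>K. c k z * c k w) - g z * g w / g a"
      by (cases "g a = 0") (simp_all add: field_simps)
    finally show ?thesis .
  qed
  \<comment> \<open>One step of a Cholesky factorization: row \<open>a\<close> accounts for the
    subtracted term \<open>g z * g w / g a\<close>, and the rows in \<open>Z\<close> factor the
    remainder, which is 0 in column \<open>a\<close>.\<close>
  define e where "e k z = (if k = a then g z / sqrt (g a) else if z = a then 0 else d k z)" for k z
  have "(\<Sum>k\<in>K. c k z * c k w) = (\<Sum>k\<in>insert a Z. e k z * e k w)"
    if "z \<in> insert a Z" "w \<in> insert a Z" for z w
  proof -
    have "(\<Sum>k\<in>Z. e k z * e k w) = (\<Sum>k\<in>K. c' k z * c' k w)"
    proof (cases "z = a \<or> w = a")
      case True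
      then have "(\<Sum>k\<in>K. c' k z * c' k w) = 0"
        using g0 g_sym by (cases "g a = 0") (auto simp: proj g_def[symmetric])
      moreover have "(\<Sum>k\<in>Z. e k z * e k w) = 0"
        using True insert.hyps by (intro sum.neutral) (auto simp: e_def)
      ultimately show ?thesis by simp
    next
      case False
      then have "(\<Sum>k\<in>Z. e k z * e k w) = (\<Sum>k\<in>Z. d k z * d k w)"
        using insert.hyps by (intro sum.cong) (auto simp: e_def)
      also have "\<dots> = (\<Sum>k\<in>K. c' k z * c' k w)"
        using False that d by simp
      finally show ?thesis .
    qed
    moreover have "e a z * e a w = g z * g w / g a"
      using ga by (simp add: e_def)
    ultimately show ?thesis
      using insert.hyps by (simp add: proj)
  qed
  then show ?case by blast
qed

lemma sum_of_squares_card: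
  assumes "sum_of_squares m n r P"
  shows "sum_of_squares m n (m * n) P"
proof -
  obtain c where P: "P = (\<lambda>x y. \<Sum>t<r. (bilin m n (c t) x y)\<^sup>2)"
    using assms unfolding sum_of_squares_iff ..
  define Z where "Z = {..<m} \<times> {..<n}"
  have "finite Z" by (simp add: Z_def)
  obtain d :: "nat \<times> nat \<Rightarrow> nat \<times> nat \<Rightarrow> real" where
    d: "\<And>z w. z \<in> Z \<Longrightarrow> w \<in> Z \<Longrightarrow>
      (\<Sum>t<r. c t (fst z) (snd z) * c t (fst w) (snd w)) = (\<Sum>k\<in>Z. d k z * d k w)"
    using gram_square_factor[OF \<open>finite Z\<close>, of "{..<r}" "\<lambda>t z. c t (fst z) (snd z)"] by auto
  obtain h where h: "bij_betw h {..<m * n} Z"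
    using ex_bij_betw_nat_finite[OF \<open>finite Z\<close>] by (auto simp: Z_def atLeast0LessThan)
  have "gram r c i j k l = gram (m * n) (\<lambda>t i j. d (h t) (i, j)) i j k l"
    if "i < m" "j < n" "k < m" "l < n" for i j k l
    using d[of "(i, j)" "(k, l)"] that sum.reindex_bij_betw[OF h, of "\<lambda>z. d z (i, j) * d z (k, l)"]
    by (simp add: gram_def Z_def)
  then have "P = (\<lambda>x y. \<Sum>t<m * n. (bilin m n (\<lambda>i j. d (h t) (i, j)) x y)\<^sup>2)"
    unfolding P sum_bilin_squared by (intro ext sum.cong refl) simp
  then show ?thesis
    unfolding sum_of_squares_iff by (rule exI[of _ "\<lambda>t i j. d (h t) (i, j)"])
qed

lemma le_BSR:
  assumes "sum_of_squares m n r P" and "\<And>s. sum_of_squares m n s P \<Longrightarrow> b \<le> s"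
  shows "b \<le> BSR m n"
proof -
  let ?R = "{sos_rank m n P | P. biquadratic_form m n P \<and> (\<exists>r. sum_of_squares m n r P)}"
  have "?R \<subseteq> {..m * n}"
    by (auto simp: sos_rank_def intro: Least_le sum_of_squares_card)
  then have "finite ?R"
    by (rule finite_subset) simp
  moreover have "sos_rank m n P \<in> ?R"
    using assms(1) biquadratic_form_if_sum_of_squares by blast
  moreover have "b \<le> sos_rank m n P"
    unfolding sos_rank_def using assms by (metis LeastI)
  ultimately show ?thesis
    unfolding BSR_def by (meson Max_ge order_trans)
qed

section \<open>Recovering Gram entries from the form\<close>

lemma bilin_add_left: "bilin m n a (\<lambda>i. x i + x' i) y = bilin m n a x y + bilin m n a x' y"
  by (simp add: bilin_def algebra_simps sum.distrib)

lemma bilin_add_right: "bilin m n a x (\<lambda>i. y i + y' i) = bilin m n a x y + bilin m n a x y'"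
  by (simp add: bilin_def algebra_simps sum.distrib)

lemma bilin_diff_left: "bilin m n a (\<lambda>i. x i - x' i) y = bilin m n a x y - bilin m n a x' y"
  by (simp add: bilin_def algebra_simps sum_subtractf)

lemma bilin_diff_right: "bilin m n a x (\<lambda>i. y i - y' i) = bilin m n a x y - bilin m n a x y'"
  by (simp add: bilin_def algebra_simps sum_subtractf)

lemma bilin_unit:
  assumes "i < m" "j < n"
  shows "bilin m n a (\<lambda>k. of_bool (k = i)) (\<lambda>l. of_bool (l = j)) = a i j"
proof -
  have "(\<Sum>l<n. a k l * of_bool (k = i) * of_bool (l = j)) = a k j * of_bool (k = i)" for k
    using assms by (subst sum_mult_of_bool_eq) auto
  then show ?thesis
    using assms by (simp add: bilin_def sum_mult_of_bool_eq)
qed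

text \<open>With signs e and d on x' and y', each bilinear form takes the value A + e B + d C + e d
  D. The alternating sum isolates the coefficient 2 (A D + B C) of e d in its square, four times
  over; hence the 8.\<close>

lemma sum_squares_bilin_polarize:
  fixes c :: "nat \<Rightarrow> nat \<Rightarrow> nat \<Rightarrow> real" and m n r :: nat
  defines "P \<equiv> \<lambda>x y. \<Sum>t<r. (bilin m n (c t) x y)\<^sup>2"
  shows "(P (\<lambda>i. x i + x' i) (\<lambda>i. y i + y' i) - P (\<lambda>i. x i - x' i) (\<lambda>i. y i + y' i)
        - P (\<lambda>i. x i + x' i) (\<lambda>i. y i - y' i) + P (\<lambda>i. x i - x' i) (\<lambda>i. y i - y' i)) / 8
    = (\<Sum>t<r. bilin m n (c t) x y * bilin m n (c t) x' y')
      + (\<Sum>t<r. bilin m n (c t) x y' * bilin m n (c t) x' y)"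
  unfolding P_def sum_subtractf[symmetric] sum.distrib[symmetric] sum_divide_distrib
  by (rule sum.cong)
    (simp_all add: bilin_add_left bilin_add_right bilin_diff_left bilin_diff_right
      power2_eq_square algebra_simps)

text \<open>The monomial \<open>x i * x k * y j * y l\<close> arises from two pairs of products, so
  the form fixes only the sum of two Gram entries. Polarization at unit vectors reads it
  off.\<close>

lemma gram_swap_eq:
  assumes "(\<lambda>x y. \<Sum>t<r. (bilin m n (c t) x y)\<^sup>2) = (\<lambda>x y. \<Sum>t<s. (bilin m n (d t) x y)\<^sup>2)"
    and "i < m" "j < n" "k < m" "l < n"
  shows "gram r c i j k l + gram r c i l k j = gram s d i j k l + gram s d i l k j"
proof -
  let ?e = "\<lambda>i k. of_bool (k = i) :: real"
  show ?thesis
    using sum_squares_bilin_polarize[where x = "?e i" and x' = "?e k" and y = "?e j" and y' = "?e l"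
        and m = m and n = n and c = c and r = r]
      sum_squares_bilin_polarize[where x = "?e i" and x' = "?e k" and y = "?e j" and y' = "?e l"
        and m = m and n = n and c = d and r = s] assms(2-5)
    by (simp only: fun_cong[OF fun_cong[OF assms(1)]] bilin_unit gram_def)
qed

text \<open>Bessel's inequality for the unit vector at \<open>k\<close> bounds the sum of
  \<open>(v a k)\<^sup>2\<close> over \<open>a\<close> by 1; summing over \<open>k\<close> counts
  the vectors, each of norm 1.\<close>

lemma card_orthonormal_le:
  fixes v :: "'a \<Rightarrow> 'b \<Rightarrow> real"
  assumes "finite A" "finite K"
    and orth: "\<And>a b. a \<in> A \<Longrightarrow> b \<in> A \<Longrightarrow> (\<Sum>k\<in>K. v a k * v b k) = of_bool (a = b)"
  shows "card A \<le> card K"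
proof -
  have bessel: "(\<Sum>a\<in>A. (v a k)\<^sup>2) \<le> 1" if "k \<in> K" for k
  proof -
    \<comment> \<open>\<open>p\<close> is the orthogonal projection of the unit vector at
      \<open>k\<close> onto the span of the \<open>v a\<close>; its squared norm is its own
      coordinate \<open>p k\<close>.\<close>
    define p where "p j = (\<Sum>a\<in>A. v a k * v a j)" for j
    have "(\<Sum>j\<in>K. (p j)\<^sup>2) = (\<Sum>j\<in>K. \<Sum>a\<in>A. \<Sum>b\<in>A. v a k * v b k * (v a j * v b j))"
      by (simp add: p_def power2_eq_square sum_product mult_ac)
    also have "\<dots> = (\<Sum>a\<in>A. \<Sum>b\<in>A. \<Sum>j\<in>K. v a k * v b k * (v a j * v b j))"
      by (simp add: sum.swap[of _ _ K])
    also have "\<dots> = (\<Sum>a\<in>A. \<Sum>b\<in>A. v a k * v b k * of_bool (a = b))"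
      by (simp add: sum_distrib_left[symmetric] orth)
    also have "\<dots> = p k"
      using \<open>finite A\<close> by (simp add: p_def of_bool_def if_distrib cong: if_cong)
    finally have "(\<Sum>j\<in>K. (p j)\<^sup>2) = p k" .
    moreover have "(p k)\<^sup>2 \<le> (\<Sum>j\<in>K. (p j)\<^sup>2)"
      using that \<open>finite K\<close> by (intro member_le_sum) auto
    ultimately have "p k * p k \<le> p k" by (simp add: power2_eq_square)
    then have "p k \<le> 1"
      by (smt (verit, best) mult_less_cancel_right1)
    then show ?thesis by (simp add: p_def power2_eq_square)
  qed
  have "real (card A) = (\<Sum>a\<in>A. \<Sum>k\<in>K. (v a k)\<^sup>2)"
    by (simp add: orth power2_eq_square)
  also have "\<dots> = (\<Sum>k\<in>K. \<Sum>a\<in>A. (v a k)\<^sup>2)"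
    by (rule sum.swap)
  also have "\<dots> \<le> (\<Sum>k\<in>K. 1)"
    by (rule sum_mono) (rule bessel)
  finally show ?thesis by simp
qed

section \<open>The explicit form and the uniqueness of its Gram matrix\<close>

text \<open>
  The products \<open>x i * y j\<close> with equal label \<open>t < 12\<close> are added up and squared; label 12 marks the
  products that do not occur.
\<close>

definition label :: "nat \<Rightarrow> nat \<Rightarrow> nat" where
  "label i j =
    [[ 0,  1,  2, 10],
     [ 3, 12, 11,  4],
     [ 5, 10, 12, 12],
     [11,  6, 12,  7],
     [12, 12,  8,  9]] ! i ! j"

definition label_coeff :: "nat \<Rightarrow> nat \<Rightarrow> nat \<Rightarrow> real" where
  "label_coeff t i j = of_bool (label i j = t)"

lemma gram_label_coeff:
  "gram 12 label_coeff i j k l = of_bool (label i j = label k l \<and> label i j < 12)"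
  by (cases "label k l < 12") (auto simp: gram_def label_coeff_def sum_mult_of_bool_eq)


lemma label_squares_rank:
  assumes "sum_of_squares 5 4 r (\<lambda>x y. \<Sum>t<12. (bilin 5 4 (label_coeff t) x y)\<^sup>2)"
  shows "12 \<le> r"
proof -
  obtain c where c: "(\<lambda>x y. \<Sum>t<r. (bilin 5 4 (c t) x y)\<^sup>2)
      = (\<lambda>x y. \<Sum>t<12. (bilin 5 4 (label_coeff t) x y)\<^sup>2)"
    using assms unfolding sum_of_squares_iff by metis
  have E: "gram r c i j k l + gram r c i l k j
      = of_bool (label i j = label k l \<and> label i j < 12) + of_bool (label i l = label k j \<and> label i l < 12)"
    if "i < 5" "j < 4" "k < 5" "l < 4" for i j k l
    using gram_swap_eq[OF c that] by (simp add: gram_label_coeff)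
  \<comment> \<open>For equal index pairs both terms of the swap relation are the same
    entry.\<close>
  have diag: "gram r c i j i j = of_bool (label i j < 12)" if "i < 5" "j < 4" for i j
    using E[OF that that] by (simp split: if_splits)
  have zero: "c t i j = 0" if "i < 5" "j < 4" "label i j = 12" "t < r" for i j t
    using diag[OF that(1,2)] that(3,4) by (simp add: gram_def sum_nonneg_eq_0_iff)
  \<comment> \<open>The zero column at \<open>(k, j)\<close> removes the swapped entry, so two unit
    vectors have inner product 1 and must be equal.\<close>
  have same: "c t i j = c t k l"
    if "i < 5" "j < 4" "k < 5" "l < 4" "label i j = label k l" "label i j < 12"
       "label i l \<noteq> label k j" "label k j = 12" "t < r" for i j k l t
  proof -
    have "gram r c i l k j = 0"
      using zero[OF that(3,2,8)] by (simp add: gram_def)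
    then have "gram r c i j k l = 1"
      using E[OF that(1-4)] that by simp
    moreover have "(\<Sum>t<r. (c t i j - c t k l)\<^sup>2)
        = gram r c i j i j - 2 * gram r c i j k l + gram r c k l k l"
      by (simp add: gram_def power2_eq_square algebra_simps sum.distrib sum_subtractf sum_distrib_left)
    ultimately have "(\<Sum>t<r. (c t i j - c t k l)\<^sup>2) = 0"
      using that diag by simp
    with \<open>t < r\<close> show ?thesis
      by (simp add: sum_nonneg_eq_0_iff)
  qed
  \<comment> \<open>Position \<open>s\<close> of the list holds one place of the table with label
    \<open>s\<close>. Labels 10 and 11 have a second place, with the same column by
    \<open>same\<close>; all places labelled 12 give the zero column.\<close>
  define v where "v s t = (case [(0,0), (0,1), (0,2), (1,0), (1,3), (2,0),
      (3,1), (3,3), (4,2), (4,3), (0,3), (1,2), (1,1)] ! s of (i, j) \<Rightarrow> c t i j)" for s t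
  define g where "g s u = (\<Sum>t<r. v s t * v u t)" for s u
  have c_eq_v: "c t i j = v (label i j) t" if "i < 5" "j < 4" "t < r" for i j t
  proof -
    have "i \<in> {0,1,2,3,4}" "j \<in> {0,1,2,3}"
      using that by auto
    moreover have "c t 2 1 = c t 0 3"
      using same[of 0 3 2 1 t] \<open>t < r\<close> by (simp add: label_def)
    moreover have "c t 3 0 = c t 1 2"
      using same[of 1 2 3 0 t] \<open>t < r\<close> by (simp add: label_def)
    moreover have "c t i j = c t 1 1" if "label i j = 12"
      using zero[of i j t] zero[of 1 1 t] that \<open>i < 5\<close> \<open>j < 4\<close> \<open>t < r\<close> by (simp add: label_def)
    ultimately show ?thesis
      by (auto simp: v_def label_def)
  qed
  \<comment> \<open>Entries now depend on labels alone, so a value found at one place of label 10 or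
    11 also holds at its other place. Each relation used for \<open>hard_values\<close> relies on
    such a label in its swapped pair.\<close>
  have gram_eq_g: "gram r c i j k l = g (label i j) (label k l)"
    if "i < 5" "j < 4" "k < 5" "l < 4" for i j k l
    using that by (simp add: gram_def g_def c_eq_v)
  have g_zero: "g s 12 = 0" "g 12 s = 0" for s
    using zero[of 1 1] by (simp_all add: g_def v_def label_def)
  have g_commute: "g s u = g u s" for s u
    by (simp add: g_def mult.commute)
  have E_g: "g (label i j) (label k l) + g (label i l) (label k j)
      = of_bool (label i j = label k l \<and> label i j < 12) + of_bool (label i l = label k j \<and> label i l < 12)"
    if "i < 5" "j < 4" "k < 5" "l < 4" for i j k l
    using E[OF that] that by (simp add: gram_eq_g)
  \<comment> \<open>One of the two entries of the swap relation vanishes, or both agree.\<close>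
  have easy: "g (label i j) (label k l) = of_bool (label i j = label k l \<and> label i j < 12)"
    if "i < 5" "j < 4" "k < 5" "l < 4" "i = k \<or> j = l \<or> label i l = 12 \<or> label k j = 12" for i j k l
    using E_g[OF that(1-4)] that(5) g_zero g_commute[of "label i l" "label k j"]
    by (auto simp: of_bool_def split: if_splits)
  \<comment> \<open>Bounded quantifiers let the simplifier expand this into explicit equations
    between values of \<open>g\<close>.\<close>
  have easy_all: "\<forall>i\<in>{..<5}. \<forall>j\<in>{..<4}. \<forall>k\<in>{..<5}. \<forall>l\<in>{..<4}.
      i = k \<or> j = l \<or> label i l = 12 \<or> label k j = 12 \<longrightarrow>
      g (label i j) (label k l) = of_bool (label i j = label k l \<and> label i j < 12)"
    by (intro ballI impI easy) (assumption | simp only: lessThan_iff)+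
  have "{..<5::nat} = {0, 1, 2, 3, 4}" "{..<4::nat} = {0, 1, 2, 3}"
    by auto
  note easy_values = easy_all[unfolded this label_def, simplified]
  \<comment> \<open>For these pairs of labels, the other entry of the swap relation is among the easy ones.\<close>
  have hard_values: "g 0 4 = 0" "g 0 6 = 0" "g 0 7 = 0" "g 1 5 = 0" "g 1 7 = 0" "g 2 3 = 0"
      "g 2 4 = 0" "g 2 9 = 0" "g 3 7 = 0" "g 4 8 = 0" "g 5 6 = 0"
    using E_g[of 0 0 1 3] E_g[of 0 0 3 1] E_g[of 0 0 3 3] E_g[of 0 1 2 0] E_g[of 0 1 3 3] E_g[of 0 2 1 0]
      E_g[of 0 2 1 3] E_g[of 0 2 4 3] E_g[of 1 0 3 3] E_g[of 1 3 4 2] E_g[of 2 0 3 1]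
    by (simp_all add: label_def easy_values)
  have "\<forall>s\<in>{..<12}. \<forall>u\<in>{..<12}. g s u = of_bool (s = u)"
    using hard_values hard_values[THEN trans[OF g_commute]]
    by (simp add: lessThan_nat_numeral easy_values)
  then have "(\<Sum>t<r. v s t * v u t) = of_bool (s = u)" if "s \<in> {..<12}" "u \<in> {..<12}" for s u
    using that by (simp add: g_def)
  then have "card {..<12::nat} \<le> card {..<r}"
    by (intro card_orthonormal_le[where v = v]) auto
  then show ?thesis by simp
qed

theorem mainTheorem2: "BSR 5 4 \<ge> 12"
proof (rule le_BSR)
  show "sum_of_squares 5 4 12 (\<lambda>x y. \<Sum>t<12. (bilin 5 4 (label_coeff t) x y)\<^sup>2)"
    unfolding sum_of_squares_iff by blast
qed (rule label_squares_rank)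

end
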